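(* Let $d\geq 0$, $n_0\geq 1$ and $k\geq 1$ be integers. Every graph $G$ with $\operatorname{mad}(G,n_0)<\frac{2d+2}{d+2}\, k$ is $k$-choosable with defect $d':=\max \{\lceil \frac{n_0-1}{k}\rceil-1,\,d\}$.
   Context: Graphs are finite and simple. For a graph $G$ and integer $n_0\geq 1$, $\operatorname{mad}(G,n_0)$ is the maximum average degree of a subgraph of $G$ with at least $n_0$ vertices, unless $|V(G)|<n_0$, in which case $\operatorname{mad}(G,n_0):=0$. In a coloured graph the monochromatic subgraph is the spanning subgraph of edges whose endpoints have the same colour. A colouring has defect $d$ if the monochromatic subgraph has maximum degree at most $d$. A $k$-list-assignment $L$ assigns to each vertex $v$ a set $L(v)$ of at least $k$ colours; an $L$-colouring colours each $v$ with a colour from $L(v)$. $G$ is $k$-choosable with defect $d$ if for every $k$-list-assignment $L$, $G$ has an $L$-colouring with defect $d$. *)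

theory Defs
  imports Complex_Main "Graph_Theory.Graph_Theory"
begin

text \<open>
  A finite simple graph is a \<^const>\<open>pair_graph\<close>: each undirected edge is represented by its two
  opposite arcs, so the degree of a vertex is its \<^const>\<open>out_degree\<close>.
\<close>

abbreviation deg :: "'a pair_pre_digraph \<Rightarrow> 'a \<Rightarrow> nat" where
  "deg G v \<equiv> out_degree (with_proj G) v"

definition average_degree :: "'a pair_pre_digraph \<Rightarrow> real" where
  "average_degree G = (\<Sum>v\<in>pverts G. real (deg G v)) / real (card (pverts G))"

text \<open>
  The conjunct \<^term>\<open>pair_graph H\<close> is needed because \<^const>\<open>subgraph\<close> is the notion for digraphs
  and would allow dropping only one of the two arcs of an edge.
\<close>

definition mad :: "'a pair_pre_digraph \<Rightarrow> nat \<Rightarrow> real" where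
  "mad G n0 =
     (if card (pverts G) < n0 then 0
      else Max {average_degree H | H.
             pair_graph H \<and> subgraph (with_proj H) (with_proj G) \<and> n0 \<le> card (pverts H)})"

definition mono_subgraph :: "'a pair_pre_digraph \<Rightarrow> ('a \<Rightarrow> 'c) \<Rightarrow> 'a pair_pre_digraph" where
  "mono_subgraph G c = \<lparr>pverts = pverts G, parcs = {(u, v) \<in> parcs G. c u = c v}\<rparr>"

definition has_defect :: "'a pair_pre_digraph \<Rightarrow> ('a \<Rightarrow> 'c) \<Rightarrow> nat \<Rightarrow> bool" where
  "has_defect G c d \<longleftrightarrow> (\<forall>v\<in>pverts G. deg (mono_subgraph G c) v \<le> d)"

text \<open>Lists may be infinite, in which case \<^const>\<open>card\<close> returns 0.\<close>

definition list_assignment :: "'a pair_pre_digraph \<Rightarrow> nat \<Rightarrow> ('a \<Rightarrow> 'c set) \<Rightarrow> bool" where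
  "list_assignment G k L \<longleftrightarrow> (\<forall>v\<in>pverts G. infinite (L v) \<or> k \<le> card (L v))"

definition list_colouring :: "'a pair_pre_digraph \<Rightarrow> ('a \<Rightarrow> 'c set) \<Rightarrow> ('a \<Rightarrow> 'c) \<Rightarrow> bool" where
  "list_colouring G L c \<longleftrightarrow> (\<forall>v\<in>pverts G. c v \<in> L v)"

text \<open>
  A definition cannot quantify over the type of colours, so that type is a parameter; a theorem
  about \<^term>\<open>choosable TYPE('c)\<close> with \<^typ>\<open>'c\<close> a type variable covers all colour types.
\<close>

definition choosable :: "'c itself \<Rightarrow> 'a pair_pre_digraph \<Rightarrow> nat \<Rightarrow> nat \<Rightarrow> bool" where
  "choosable _ G k d \<longleftrightarrow>
     (\<forall>L :: 'a \<Rightarrow> 'c set. list_assignment G k L \<longrightarrow>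
        (\<exists>c. list_colouring G L c \<and> has_defect G c d))"

end

theory Submission
  imports Defs
begin

text \<open>
  If some nonempty \<open>S \<subseteq> X\<close> satisfies \<open>(d + 1) deg\<^sub>X v < (d + 1) k + d deg\<^sub>S v\<close> for all \<open>v \<in> S\<close>,
  then a colouring of \<open>X - S\<close> extends to \<open>X\<close>: delete from the lists on \<open>S\<close> the colours of the
  neighbours outside \<open>S\<close> and colour \<open>S\<close> from the remaining lists with as few monochromatic edges
  as possible. If there is no such \<open>S\<close>, then peeling off violating vertices one by one and summing
  their inequalities shows that \<open>X\<close> induces a subgraph of average degree at least
  \<open>(2 d + 2) k / (d + 2)\<close>, so that \<open>X\<close> has fewer than \<open>n\<^sub>0\<close> vertices. In that case a colouring with
  the fewest monochromatic edges works, as degrees are at most \<open>\<bar>X\<bar> - 1\<close>.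
\<close>

text \<open>A relation together with a vertex set serves adjacency, its monochromatic part and all
  induced subgraphs alike.\<close>

abbreviation deg_in :: "('a \<Rightarrow> 'a \<Rightarrow> bool) \<Rightarrow> 'a set \<Rightarrow> 'a \<Rightarrow> nat" where
  "deg_in R S v \<equiv> card {u \<in> S. R v u}"

text \<open>Each edge at \<open>v\<close> is counted twice in the degree sum, once at
  \<open>v\<close> and once at its other end.\<close>

lemma sum_deg_in_remove:
  assumes "finite S" "v \<in> S" "symp R" "irreflp R"
  shows "(\<Sum>w\<in>S. deg_in R S w) = (\<Sum>w\<in>S - {v}. deg_in R (S - {v}) w) + 2 * deg_in R S v"
proof -
  have *: "deg_in R S w = deg_in R (S - {v}) w + (if R v w then 1 else 0)" for w
  proof -
    have "{u \<in> S. R w u} = {u \<in> S - {v}. R w u} \<union> (if R v w then {v} else {})"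
      using assms(2,3) by (auto dest: sympD)
    then show ?thesis
      using assms(1) by (simp add: card_Un_disjoint)
  qed
  have "{w \<in> S - {v}. R v w} = {w \<in> S. R v w}"
    using assms(4) by (auto simp: irreflp_def)
  then have "(\<Sum>w\<in>S - {v}. if R v w then 1 else 0) = deg_in R S v"
    using assms(1) by (simp flip: sum.inter_filter)
  then show ?thesis
    using assms(1,2) by (simp add: sum.remove[of S v] * sum.distrib)
qed

text \<open>In a colouring with the fewest monochromatic edges, recolouring \<open>v\<close> gains
  nothing, so each colour in \<open>M v\<close> occurs on at least as many neighbours of
  \<open>v\<close> as \<open>c v\<close> does. These sets of neighbours are disjoint for different
  colours, which gives the product bound.\<close>

lemma exists_colouring_few_monochromatic:
  fixes M :: "'a \<Rightarrow> 'c set"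
  assumes "finite S" "symp R" "irreflp R"
    and M: "\<forall>v\<in>S. finite (M v) \<and> M v \<noteq> {}"
  obtains c where "\<And>v. v \<in> S \<Longrightarrow> c v \<in> M v"
    and "\<And>v. v \<in> S \<Longrightarrow> deg_in (\<lambda>x y. R x y \<and> c x = c y) S v * card (M v) \<le> deg_in R S v"
proof -
  define Q where "Q c = (\<lambda>x y. R x y \<and> c x = c y)" for c :: "'a \<Rightarrow> 'c"
  \<comment> \<open>Every monochromatic edge inside \<open>S\<close> contributes 2 to
    \<open>cost c\<close>.\<close>
  define cost where "cost c = (\<Sum>v\<in>S. deg_in (Q c) S v)" for c
  have "\<forall>v\<in>S. (SOME a. a \<in> M v) \<in> M v"
    using M by (simp add: some_in_eq)
  then have "\<exists>c. \<forall>v\<in>S. c v \<in> M v"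
    by (rule exI[of _ "\<lambda>v. SOME a. a \<in> M v"])
  then obtain c where c: "\<forall>v\<in>S. c v \<in> M v"
    and min: "\<And>c'. \<forall>v\<in>S. c' v \<in> M v \<Longrightarrow> cost c \<le> cost c'"
    using ex_has_least_nat[of "\<lambda>c. \<forall>v\<in>S. c v \<in> M v" _ cost] by metis
  have split: "cost c' = (\<Sum>w\<in>S - {v}. deg_in (Q c') (S - {v}) w) + 2 * deg_in (Q c') S v"
    if "v \<in> S" for c' v
    unfolding cost_def using assms that
    by (intro sum_deg_in_remove) (auto simp: Q_def symp_def irreflp_def)
  have "deg_in (Q c) S v * card (M v) \<le> deg_in R S v" if v: "v \<in> S" for v
  proof -
    have "deg_in (Q c) S v \<le> card {u \<in> S. R v u \<and> c u = a}" if a: "a \<in> M v" for a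
    proof -
      let ?c' = "c(v := a)"
      have "cost c \<le> cost ?c'"
        using c a by (intro min) simp
      \<comment> \<open>Recolouring \<open>v\<close> affects only edges at \<open>v\<close>, so
        comparing costs amounts to comparing monochromatic degrees at \<open>v\<close>.\<close>
      moreover have "(\<Sum>w\<in>S - {v}. deg_in (Q ?c') (S - {v}) w) =
          (\<Sum>w\<in>S - {v}. deg_in (Q c) (S - {v}) w)"
        by (intro sum.cong refl arg_cong[of _ _ card]) (auto simp: Q_def)
      ultimately have "deg_in (Q c) S v \<le> deg_in (Q ?c') S v"
        using split[OF v, of c] split[OF v, of ?c'] by simp
      also have "{u \<in> S. Q ?c' v u} = {u \<in> S. R v u \<and> c u = a}"
        using assms(3) by (auto simp: Q_def irreflp_def)
      finally show ?thesis .
    qed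
    then have "card (M v) * deg_in (Q c) S v \<le> (\<Sum>a\<in>M v. card {u \<in> S. R v u \<and> c u = a})"
      using sum_bounded_below[of "M v" "deg_in (Q c) S v"] by simp
    also have "\<dots> = card (\<Union>a\<in>M v. {u \<in> S. R v u \<and> c u = a})"
      using assms(1) M v by (intro card_UN_disjoint[symmetric]) auto
    also have "\<dots> \<le> deg_in R S v"
      using assms(1) by (intro card_mono) auto
    finally show ?thesis
      by (simp add: mult.commute)
  qed
  with c show ?thesis
    by (intro that[of c]) (auto simp: Q_def)
qed

text \<open>With \<open>X\<close> split into \<open>S\<close> and its complement, the inequality
  says that \<open>deg_in R S v\<close> is less than \<open>d + 1\<close> times
  \<open>k - deg_in R (X - S) v\<close>, where the latter bounds from below the number of colours
  left at \<open>v\<close> once \<open>X - S\<close> is coloured.\<close>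

lemma exists_reducible_subset:
  fixes d k :: nat
  assumes "finite X" "symp R" "irreflp R"
    and sparse: "(d + 2) * (\<Sum>v\<in>X. deg_in R X v) < (2 * d + 2) * k * card X"
  obtains (reducible) S where "S \<subseteq> X" "S \<noteq> {}"
    and "\<And>v. v \<in> S \<Longrightarrow> (d + 1) * deg_in R X v < (d + 1) * k + d * deg_in R S v"
proof (rule ccontr)
  assume no_thesis: "\<not> thesis"
  have bad: "\<exists>v\<in>S. (d + 1) * k + d * deg_in R S v \<le> (d + 1) * deg_in R X v"
    if S: "S \<subseteq> X" "S \<noteq> {}" for S
    using no_thesis S reducible by (meson not_le)
  \<comment> \<open>The inequalities of the peeled vertices are summed with factor 2, because
    removing \<open>v\<close> lowers the first degree sum by \<open>2 * deg_in R S v\<close>. For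
    \<open>S = X\<close> both degree sums agree, leaving the coefficient
    \<open>2 * (d + 1) - d = d + 2\<close>.\<close>
  have "d * (\<Sum>v\<in>S. deg_in R S v) + 2 * (d + 1) * k * card S \<le> 2 * (d + 1) * (\<Sum>v\<in>S. deg_in R X v)"
    if "S \<subseteq> X" for S
    using finite_subset[OF that assms(1)] that
  proof (induction S rule: finite_remove_induct)
    case empty
    then show ?case by simp
  next
    case (remove S)
    then obtain v where v: "v \<in> S"
      and le: "(d + 1) * k + d * deg_in R S v \<le> (d + 1) * deg_in R X v"
      using bad by blast
    have S: "card S = card (S - {v}) + 1"
      using remove.hyps v by (simp add: card_gt_0_iff)
    have IH: "d * (\<Sum>w\<in>S - {v}. deg_in R (S - {v}) w) + 2 * (d + 1) * k * card (S - {v})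
        \<le> 2 * (d + 1) * (\<Sum>w\<in>S - {v}. deg_in R X w)"
      using remove v by blast
    have X: "(\<Sum>w\<in>S. deg_in R X w) = deg_in R X v + (\<Sum>w\<in>S - {v}. deg_in R X w)"
      using remove.hyps v by (simp add: sum.remove)
    show ?case
      unfolding sum_deg_in_remove[OF remove.hyps(1) v assms(2,3)] S X
      using IH le by (simp add: algebra_simps)
  qed
  from this[of X] sparse show False
    by (simp add: algebra_simps)
qed

text \<open>The sparsity hypothesis passes to subsets of \<open>X\<close>, so induction can colour
  \<open>X - S\<close> for a reducible \<open>S\<close>. The empty set is excluded there since both
  sides of the strict inequality vanish on it.\<close>

lemma exists_defective_colouring:
  fixes M :: "'a \<Rightarrow> 'c set" and d d' k n0 :: nat
  assumes "finite X" "symp R" "irreflp R" "k \<ge> 1"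
    and M: "\<And>v. v \<in> X \<Longrightarrow> finite (M v) \<and> card (M v) = k"
    and sparse: "\<And>Y. Y \<subseteq> X \<Longrightarrow> n0 \<le> card Y \<Longrightarrow> Y \<noteq> {} \<Longrightarrow>
      (d + 2) * (\<Sum>v\<in>Y. deg_in R Y v) < (2 * d + 2) * k * card Y"
    and d': "d \<le> d'" "n0 \<le> k * (d' + 1) + 1"
  shows "\<exists>c. \<forall>v\<in>X. c v \<in> M v \<and> deg_in (\<lambda>x y. R x y \<and> c x = c y) X v \<le> d'"
  using assms(1) M sparse
proof (induction X rule: finite_psubset_induct)
  case (psubset X)
  show ?case
  proof (cases "n0 \<le> card X \<and> X \<noteq> {}")
    case False
    have "\<forall>v\<in>X. finite (M v) \<and> M v \<noteq> {}"
      using psubset.prems(1) assms(4) by fastforce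
    then obtain c where c: "\<And>v. v \<in> X \<Longrightarrow> c v \<in> M v"
      and le: "\<And>v. v \<in> X \<Longrightarrow>
        deg_in (\<lambda>x y. R x y \<and> c x = c y) X v * card (M v) \<le> deg_in R X v"
      using exists_colouring_few_monochromatic[OF psubset.hyps(1) assms(2,3)] by blast
    have "deg_in (\<lambda>x y. R x y \<and> c x = c y) X v \<le> d'" if v: "v \<in> X" for v
    proof -
      have "deg_in R X v < card X"
        using psubset.hyps v assms(3) by (intro psubset_card_mono) (auto simp: irreflp_def)
      \<comment> \<open>As \<open>v\<close> lies in \<open>X\<close>, the failing condition is
        \<open>n0 \<le> card X\<close>; hence \<open>card X\<close> is at most
        \<open>n0 - 1\<close>, and so at most \<open>k * (d' + 1)\<close>.\<close>
      then have "deg_in R X v < (d' + 1) * k"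
        using False d'(2) v by (auto simp: algebra_simps)
      then have "deg_in (\<lambda>x y. R x y \<and> c x = c y) X v * k < (d' + 1) * k"
        using le[OF v] psubset.prems(1)[OF v] by simp
      then have "deg_in (\<lambda>x y. R x y \<and> c x = c y) X v < d' + 1"
        by (simp only: mult_less_cancel2)
      then show ?thesis
        by simp
    qed
    with c show ?thesis by blast
  next
    case True
    obtain S where S: "S \<subseteq> X" "S \<noteq> {}"
      and red: "\<And>v. v \<in> S \<Longrightarrow> (d + 1) * deg_in R X v < (d + 1) * k + d * deg_in R S v"
      using exists_reducible_subset[OF psubset.hyps assms(2,3) psubset.prems(2)] True by blast
    have fin: "finite S" "finite (X - S)"
      using S psubset.hyps finite_subset by auto
    have "\<exists>c. \<forall>v\<in>X - S. c v \<in> M v \<and> deg_in (\<lambda>x y. R x y \<and> c x = c y) (X - S) v \<le> d'"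
      using S psubset.prems by (intro psubset.IH) auto
    then obtain c0 where c0: "\<And>v. v \<in> X - S \<Longrightarrow> c0 v \<in> M v"
      and c0_le: "\<And>v. v \<in> X - S \<Longrightarrow> deg_in (\<lambda>x y. R x y \<and> c0 x = c0 y) (X - S) v \<le> d'"
      by blast
    define N where "N v = M v - c0 ` {u \<in> X - S. R v u}" for v
    have N: "finite (N v)" "deg_in R S v < (d + 1) * card (N v)" if v: "v \<in> S" for v
    proof -
      have Mv: "finite (M v)" "card (M v) = k"
        using psubset.prems(1) S v by auto
      then show "finite (N v)"
        by (simp add: N_def)
      have "{u \<in> X. R v u} = {u \<in> S. R v u} \<union> {u \<in> X - S. R v u}"
        using S by auto
      then have X: "deg_in R X v = deg_in R S v + deg_in R (X - S) v"
        using fin by (simp add: card_Un_disjoint disjoint_iff)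
      \<comment> \<open>Each outside neighbour deletes at most one colour. The subtraction is
        truncated, so the next step restates the bound with a sum.\<close>
      have "k - deg_in R (X - S) v \<le> card (N v)"
        unfolding N_def using fin Mv
          card_image_le[of "{u \<in> X - S. R v u}" c0]
          diff_card_le_card_Diff[of "c0 ` {u \<in> X - S. R v u}" "M v"]
        by simp
      then have "(d + 1) * k \<le> (d + 1) * (card (N v) + deg_in R (X - S) v)"
        by (intro mult_le_mono2) simp
      with red[OF v] show "deg_in R S v < (d + 1) * card (N v)"
        by (simp add: X algebra_simps)
    qed
    have "\<forall>v\<in>S. finite (N v) \<and> N v \<noteq> {}"
      using N by fastforce
    then obtain c1 where c1: "\<And>v. v \<in> S \<Longrightarrow> c1 v \<in> N v"
      and le: "\<And>v. v \<in> S \<Longrightarrow>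
        deg_in (\<lambda>x y. R x y \<and> c1 x = c1 y) S v * card (N v) \<le> deg_in R S v"
      using exists_colouring_few_monochromatic[OF fin(1) assms(2,3)] by blast
    define c where "c v = (if v \<in> S then c1 v else c0 v)" for v
    \<comment> \<open>No edge between \<open>S\<close> and \<open>X - S\<close> becomes
      monochromatic, so monochromatic degrees can be checked in the two parts separately.\<close>
    have cross: "c1 v \<noteq> c0 u" if "v \<in> S" "u \<in> X - S" "R v u" for u v
      using c1[OF that(1)] that by (auto simp: N_def)
    have "deg_in (\<lambda>x y. R x y \<and> c x = c y) X v \<le> d'" if v: "v \<in> X" for v
    proof (cases "v \<in> S")
      case True
      have "{u \<in> X. R v u \<and> c v = c u} = {u \<in> S. R v u \<and> c1 v = c1 u}"
        using cross True S by (auto simp: c_def)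
      \<comment> \<open>Cancelling \<open>card (N v)\<close> gives defect \<open>d\<close> on
        \<open>S\<close>; the larger \<open>d'\<close> comes from the base case.\<close>
      moreover have "deg_in (\<lambda>x y. R x y \<and> c1 x = c1 y) S v < d + 1"
        using le[OF True] N(2)[OF True] by (metis le_less_trans mult_less_cancel2)
      ultimately show ?thesis
        using d'(1) by simp
    next
      case False
      have "{u \<in> X. R v u \<and> c v = c u} = {u \<in> X - S. R v u \<and> c0 v = c0 u}"
        using cross False v S assms(2) by (fastforce simp: c_def dest: sympD)
      then show ?thesis
        using c0_le False v by simp
    qed
    moreover have "c v \<in> M v" if "v \<in> X" for v
      using c0 c1 that by (auto simp: c_def N_def)
    ultimately show ?thesis by blast
  qed
qed

text \<open>The bound needs the \<open>Max\<close> to range over a finite set: a subgraph is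
  determined by its vertex set and its arc set, both subsets of those of \<open>G\<close>.\<close>

lemma average_degree_le_mad:
  assumes "pair_graph G" "pair_graph H" "subgraph (with_proj H) (with_proj G)"
    and "n0 \<le> card (pverts H)"
  shows "average_degree H \<le> mad G n0"
proof -
  interpret G: pair_graph G by fact
  let ?A = "{H. pair_graph H \<and> subgraph (with_proj H) (with_proj G) \<and> n0 \<le> card (pverts H)}"
  have "?A \<subseteq> (\<lambda>(V, A). \<lparr>pverts = V, parcs = A\<rparr>) ` (Pow (pverts G) \<times> Pow (parcs G))"
  proof
    fix K assume "K \<in> ?A"
    then have "K = (\<lambda>(V, A). \<lparr>pverts = V, parcs = A\<rparr>) (pverts K, parcs K)"
      "(pverts K, parcs K) \<in> Pow (pverts G) \<times> Pow (parcs G)"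
      by (auto simp: subgraph_def)
    then show "K \<in> (\<lambda>(V, A). \<lparr>pverts = V, parcs = A\<rparr>) ` (Pow (pverts G) \<times> Pow (parcs G))"
      by (rule image_eqI)
  qed
  then have "finite ?A"
    by (rule finite_subset) simp
  then have fin: "finite (average_degree ` ?A)"
    by (rule finite_imageI)
  have "pverts H \<subseteq> pverts G"
    using assms(3) by (auto simp: subgraph_def)
  then have "n0 \<le> card (pverts G)"
    using assms(4) card_mono[OF G.pair_finite_verts] le_trans by blast
  then have "mad G n0 = Max (average_degree ` ?A)"
    by (simp add: mad_def image_Collect)
  then show ?thesis
    using fin assms by simp
qed

lemma deg_eq_deg_in:
  assumes "parcs G \<subseteq> pverts G \<times> pverts G"
  shows "deg G v = deg_in (\<lambda>x y. (x, y) \<in> parcs G) (pverts G) v"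
proof -
  have "out_arcs (with_proj G) v = Pair v ` {u \<in> pverts G. (v, u) \<in> parcs G}"
    using assms by (auto simp: out_arcs_def)
  then show ?thesis
    by (simp add: out_degree_def card_image inj_on_def)
qed

theorem theorem7:
  fixes G :: "'a pair_pre_digraph" and d n0 k :: nat
  assumes "n0 \<ge> 1" and "k \<ge> 1"
    and "pair_graph G"
    and "mad G n0 < (2 * real d + 2) / (real d + 2) * real k"
  shows "choosable TYPE('c) G k (nat (max (\<lceil>(real n0 - 1) / real k\<rceil> - 1) (int d)))"
  unfolding choosable_def
proof (intro allI impI)
  fix L :: "'a \<Rightarrow> 'c set"
  assume L: "list_assignment G k L"
  interpret G: pair_graph G by fact
  define R where "R x y \<longleftrightarrow> (x, y) \<in> parcs G" for x y
  define d' where "d' = nat (max (\<lceil>(real n0 - 1) / real k\<rceil> - 1) (int d))"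
  have R: "symp R" "irreflp R"
    using G.arcs_symmetric G.no_loops' by (auto simp: symp_def irreflp_def R_def)
  have arcs: "parcs G \<subseteq> pverts G \<times> pverts G"
    by (auto dest: G.in_arcsD1 G.in_arcsD2)
  \<comment> \<open>Trimming every list to exactly \<open>k\<close> colours covers long and infinite
    lists.\<close>
  have "\<exists>M. finite M \<and> card M = k \<and> M \<subseteq> L v" if "v \<in> pverts G" for v
    using L that obtain_subset_with_card_n[of k "L v"] infinite_arbitrarily_large[of "L v" k]
    by (metis card_gt_0_iff finite_subset list_assignment_def)
  then obtain M where M: "\<And>v. v \<in> pverts G \<Longrightarrow> finite (M v) \<and> card (M v) = k \<and> M v \<subseteq> L v"
    by metis
  have sparse: "(d + 2) * (\<Sum>v\<in>Y. deg_in R Y v) < (2 * d + 2) * k * card Y"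
    if Y: "Y \<subseteq> pverts G" "n0 \<le> card Y" "Y \<noteq> {}" for Y
  proof -
    \<comment> \<open>The subgraph induced by \<open>Y\<close> has at least \<open>n0\<close>
      vertices, so its average degree is bounded by \<open>mad G n0\<close>.\<close>
    define H where "H = \<lparr>pverts = Y, parcs = {(u, v) \<in> parcs G. u \<in> Y \<and> v \<in> Y}\<rparr>"
    have fin: "finite Y"
      using Y by (simp add: finite_subset)
    have "symmetric (with_proj H)"
      using G.arcs_symmetric by (auto simp: symmetric_def sym_def H_def)
    then have "pair_graph H"
      using fin G.pair_finite_arcs G.pair_no_loops
      by unfold_locales
        (auto simp: H_def intro: finite_subset[of _ "parcs G"])
    moreover from this have "subgraph (with_proj H) (with_proj G)"
      using Y(1) G.wf_digraph wf_digraph_wp_iff[of H]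
      by (auto simp: subgraph_def compatible_def H_def pair_graph_def pair_digraph_def
          pair_fin_digraph_def)
    ultimately have "average_degree H \<le> mad G n0"
      using average_degree_le_mad[OF assms(3), of H n0] Y(2) by (simp add: H_def)
    moreover have "average_degree H = real (\<Sum>v\<in>Y. deg_in R Y v) / real (card Y)"
    proof -
      have "deg H v = deg_in R Y v" if "v \<in> Y" for v
        unfolding deg_eq_deg_in[of H] using that
        by (subst deg_eq_deg_in) (auto simp: H_def R_def intro: arg_cong[of _ _ card])
      then show ?thesis
        by (simp add: average_degree_def H_def)
    qed
    moreover have "card Y > 0"
      using Y fin by (simp add: card_gt_0_iff)
    ultimately have "real (\<Sum>v\<in>Y. deg_in R Y v) / real (card Y)
        < (2 * real d + 2) / (real d + 2) * real k"
      using assms(4) by simp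
    then have "real ((d + 2) * (\<Sum>v\<in>Y. deg_in R Y v)) < real ((2 * d + 2) * k * card Y)"
      using \<open>card Y > 0\<close> by (simp add: field_simps del: of_nat_sum)
    then show ?thesis
      by (simp only: of_nat_less_iff)
  qed
  have "d \<le> d'"
    by (simp add: d'_def)
  \<comment> \<open>The ceiling in \<open>d'\<close> is chosen so that \<open>d' + 1\<close> is at
    least \<open>(n0 - 1) / k\<close>.\<close>
  moreover have "n0 \<le> k * (d' + 1) + 1"
  proof -
    have "(real n0 - 1) / real k \<le> real_of_int \<lceil>(real n0 - 1) / real k\<rceil>"
      by simp
    also have "\<dots> \<le> real (d' + 1)"
      unfolding d'_def by linarith
    finally have "real n0 \<le> real (k * (d' + 1) + 1)"
      using assms(2) by (simp add: field_simps)
    then show ?thesis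
      by (simp only: of_nat_le_iff)
  qed
  ultimately have "\<exists>c. \<forall>v\<in>pverts G.
      c v \<in> M v \<and> deg_in (\<lambda>x y. R x y \<and> c x = c y) (pverts G) v \<le> d'"
    using M sparse
    by (intro exists_defective_colouring[OF G.pair_finite_verts R assms(2), where ?n0.0 = n0 and d = d])
      blast+
  then obtain c where c: "\<And>v. v \<in> pverts G \<Longrightarrow> c v \<in> M v"
    and le: "\<And>v. v \<in> pverts G \<Longrightarrow> deg_in (\<lambda>x y. R x y \<and> c x = c y) (pverts G) v \<le> d'"
    by blast
  have "list_colouring G L c"
    using c M by (auto simp: list_colouring_def)
  moreover have "has_defect G c d'"
    unfolding has_defect_def
  proof
    fix v assume v: "v \<in> pverts G"
    show "deg (mono_subgraph G c) v \<le> d'"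
      using arcs le v by (subst deg_eq_deg_in) (auto simp: mono_subgraph_def R_def)
  qed
  ultimately show "\<exists>c. list_colouring G L c \<and>
      has_defect G c (nat (max (\<lceil>(real n0 - 1) / real k\<rceil> - 1) (int d)))"
    unfolding d'_def by blast
qed

end
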